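(* For $n\ge1$ let $T_{2n}=\sum_{V\in\mathcal{P}_2(2n)}h(V)$ and $p_{2n}=(2n-1)!!=\sum_{V\in\mathcal{P}_2(2n)}1$, with $p_0=1$. Then for every $n\ge 0$, $$T_{2n+2}=(n+1)\sum_{k=0}^{n}p_{2k}\,p_{2n-2k}.$$
   Context: $\mathcal{P}_2(2n)$ is the set of pair-partitions of $\{1,\dots,2n\}$ (partitions into $n$ blocks of size two, each block written $(i,j)$ with $i<j$). Two blocks $(i_1,j_1),(i_2,j_2)$ cross if $i_1<i_2<j_1<j_2$ or $i_2<i_1<j_2<j_1$. A block of $V\in\mathcal{P}_2(2n)$ is a singleton if it crosses no other block of $V$, and $h(V)$ is the number of singletons of $V$. *)

theory Defs
  imports Complex_Main "HOL-Library.Disjoint_Sets"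
begin

definition pair_partitions :: "nat \<Rightarrow> nat set set set" where
  "pair_partitions m = {V. partition_on {1..m} V \<and> (\<forall>B\<in>V. card B = 2)}"

lemma finite_pair_partitions: "finite (pair_partitions m)"
proof -
  have "pair_partitions m \<subseteq> {V. partition_on {1..m} V}"
    by (auto simp: pair_partitions_def)
  then show ?thesis
    using finitely_many_partition_on[of "{1..m}"] finite_subset by blast
qed

(* In either alternative the inequalities force i1 < j1 and i2 < j2,
   so (i1, j1) and (i2, j2) are the blocks B and C written in increasing order. *)
definition crosses :: "nat set \<Rightarrow> nat set \<Rightarrow> bool" where
  "crosses B C \<longleftrightarrow>
     (\<exists>i1 j1 i2 j2. B = {i1, j1} \<and> C = {i2, j2} \<and>
        (i1 < i2 \<and> i2 < j1 \<and> j1 < j2 \<or> i2 < i1 \<and> i1 < j2 \<and> j2 < j1))"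

(* Not one-element blocks: "singleton" refers to the crossing structure. *)
definition singletons :: "nat set set \<Rightarrow> nat set set" where
  "singletons V = {B \<in> V. \<forall>C\<in>V - {B}. \<not> crosses B C}"

definition h :: "nat set set \<Rightarrow> nat" where
  "h V = card (singletons V)"

definition T :: "nat \<Rightarrow> nat" where
  "T m = (\<Sum>V\<in>pair_partitions m. h V)"

definition p :: "nat \<Rightarrow> nat" where
  "p m = (\<Sum>V\<in>pair_partitions m. 1)"

fun double_fact :: "nat \<Rightarrow> nat" where
  "double_fact 0 = 1"
| "double_fact (Suc 0) = 1"
| "double_fact (Suc (Suc n)) = Suc (Suc n) * double_fact n"

end

theory Submission
  imports Defs
begin

text \<open>
  Count pairs \<open>(V, {i, j})\<close> in which \<open>{i, j}\<close> is an uncrossed block of \<open>V\<close>. Every other block then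
  lies either strictly between \<open>i\<close> and \<open>j\<close> or outside \<open>[i, j]\<close>, so a gap \<open>d = j - i - 1\<close> contributes
  \<open>p d * p (2n - d)\<close>, and there are \<open>2n + 1 - d\<close> pairs with that gap. Only even \<open>d = 2k\<close> matter, and
  averaging with \<open>k \<mapsto> n - k\<close> replaces the weight \<open>2n + 1 - 2k\<close> by \<open>n + 1\<close>.
\<close>

section \<open>Perfect matchings of a finite set and their number\<close>

text \<open>Deleting a block from \<open>{1..m}\<close>, or cutting it into the inside and outside
  of a block, leaves sets that need not be initial intervals, so the counting is done over arbitrary
  ground sets.\<close>

definition matchings :: "'a set \<Rightarrow> 'a set set set" where
  "matchings S = {V. partition_on S V \<and> (\<forall>B\<in>V. card B = 2)}"

lemma pair_partitions_eq_matchings: "pair_partitions m = matchings {1..m}"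
  by (simp add: pair_partitions_def matchings_def)

lemma finite_matchings: "finite S \<Longrightarrow> finite (matchings S)"
  unfolding matchings_def
  by (rule finite_subset[OF _ finitely_many_partition_on[of S]]) auto

text \<open>Deleting \<open>B\<close> and inserting it again are mutually inverse. The predicate
  \<open>P\<close> on the remaining blocks lets one bijection serve both the recursion for the
  number of matchings (\<open>P\<close> constantly true) and the requirement that no other block
  crosses \<open>B\<close>.\<close>

lemma matchings_containing:
  assumes "B \<subseteq> S" "card B = 2"
  shows "{V \<in> matchings S. B \<in> V \<and> P (V - {B})} = insert B ` {W \<in> matchings (S - B). P W}"
proof -
  have ne: "B \<noteq> {}" using assms(2) by auto
  have ins: "insert B W \<in> matchings S \<longleftrightarrow> W \<in> matchings (S - B)" if "disjnt B (\<Union>W)" for W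
    using partition_on_insert[OF that, of S] assms ne by (auto simp: matchings_def)
  have dis: "disjnt B (\<Union>W)" if "W \<in> matchings (S - B)" for W
    using that by (auto simp: matchings_def partition_on_def disjnt_def)
  show ?thesis
  proof (intro equalityI subsetI)
    fix V assume V: "V \<in> {V \<in> matchings S. B \<in> V \<and> P (V - {B})}"
    then have "disjoint V" by (simp add: matchings_def partition_on_def)
    then have "disjnt B (\<Union>(V - {B}))"
      using V by (auto simp: disjoint_def disjnt_def)
    moreover have "insert B (V - {B}) = V" using V by auto
    ultimately have "V - {B} \<in> matchings (S - B)" using ins V by fastforce
    then show "V \<in> insert B ` {W \<in> matchings (S - B). P W}"
      using V \<open>insert B (V - {B}) = V\<close> by (intro image_eqI[of _ _ "V - {B}"]) auto
  next
    fix V assume "V \<in> insert B ` {W \<in> matchings (S - B). P W}"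
    then obtain W where W: "V = insert B W" "W \<in> matchings (S - B)" "P W" by auto
    have "B \<notin> W" using dis[OF W(2)] ne by (auto simp: disjnt_def)
    then show "V \<in> {V \<in> matchings S. B \<in> V \<and> P (V - {B})}"
      using W ins[OF dis[OF W(2)]] by auto
  qed
qed

lemma card_matchings_containing:
  assumes "B \<subseteq> S" "card B = 2"
  shows "card {V \<in> matchings S. B \<in> V \<and> P (V - {B})} = card {W \<in> matchings (S - B). P W}"
proof -
  have "B \<noteq> {}" using assms(2) by auto
  then have "B \<notin> W" if "W \<in> matchings (S - B)" for W
    using that by (auto simp: matchings_def partition_on_def)
  then have "inj_on (insert B) {W \<in> matchings (S - B). P W}"
    by (intro inj_onI) (metis (no_types, lifting) insert_ident mem_Collect_eq)
  then show ?thesis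
    by (simp add: matchings_containing[OF assms] card_image)
qed

text \<open>For \<open>S = {}\<close> the truncated subtraction yields \<open>double_fact 0 = 1\<close>, the convention \<open>(-1)!! = 1\<close>.\<close>

lemma card_matchings:
  assumes "finite S"
  shows "card (matchings S) = (if even (card S) then double_fact (card S - 1) else 0)"
  using assms
proof (induction "card S" arbitrary: S rule: less_induct)
  case less
  show ?case
  proof (cases "S = {}")
    case True
    then have "matchings S = {{}}" by (auto simp: matchings_def partition_on_def)
    then show ?thesis using True by simp
  next
    case False
    then obtain x where x: "x \<in> S" by auto
    \<comment> \<open>Matchings are classified by the partner \<open>y\<close> of the fixed point
      \<open>x\<close>: the classes cover everything by \<open>partner\<close> and are disjoint by
      \<open>uniq\<close>. Each of the \<open>card S - 1\<close> partners leaves a set with two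
      points fewer.\<close>
    have partner: "\<exists>y \<in> S - {x}. {x, y} \<in> V" if "V \<in> matchings S" for V
    proof -
      have "\<Union>V = S" using that by (auto simp: matchings_def partition_on_def)
      then obtain B where B: "B \<in> V" "x \<in> B" using x by blast
      then have "card B = 2" "B \<subseteq> S" using that by (auto simp: matchings_def partition_on_def)
      then obtain a b where "B = {a, b}" "a \<noteq> b" by (auto simp: card_2_iff)
      then have "\<exists>y. y \<noteq> x \<and> B = {x, y}" using B(2) by auto
      then obtain y where "y \<noteq> x" "B = {x, y}" by blast
      then show ?thesis using B \<open>B \<subseteq> S\<close> by blast
    qed
    have uniq: "y = z" if "V \<in> matchings S" "{x, y} \<in> V" "{x, z} \<in> V" for V y z
    proof -
      have "disjoint V" using that by (simp add: matchings_def partition_on_def)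
      then have "{x, y} = {x, z}"
        using that(2,3) disjointD by blast
      then show ?thesis by (auto simp: doubleton_eq_iff)
    qed
    have "matchings S = (\<Union>y\<in>S - {x}. {V \<in> matchings S. {x, y} \<in> V})"
      using partner by auto
    also have "card \<dots> = (\<Sum>y\<in>S - {x}. card {V \<in> matchings S. {x, y} \<in> V})"
      using less.prems uniq by (intro card_UN_disjoint) (auto simp: finite_matchings)
    also have "\<dots> = (\<Sum>y\<in>S - {x}. if even (card S) then double_fact (card S - 2 - 1) else 0)"
    proof (rule sum.cong)
      fix y assume y: "y \<in> S - {x}"
      then have sub: "{x, y} \<subseteq> S" "card {x, y} = 2" using x by auto
      have c: "card (S - {x, y}) = card S - 2" using sub by (simp add: card_Diff_subset)
      have ge: "card S \<ge> 2" using card_mono[OF less.prems sub(1)] sub(2) by simp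
      have "card {V \<in> matchings S. {x, y} \<in> V} = card (matchings (S - {x, y}))"
        using card_matchings_containing[OF sub, of "\<lambda>_. True"] by simp
      also have "\<dots> = (if even (card S) then double_fact (card S - 2 - 1) else 0)"
        using less.hyps[of "S - {x, y}"] less.prems c ge by simp
      finally show "card {V \<in> matchings S. {x, y} \<in> V} =
        (if even (card S) then double_fact (card S - 2 - 1) else 0)" .
    qed simp
    also have "\<dots> = (if even (card S) then (card S - 1) * double_fact (card S - 2 - 1) else 0)"
      using x less.prems by simp
    also have "\<dots> = (if even (card S) then double_fact (card S - 1) else 0)"
    \<comment> \<open>For even \<open>card S = Suc k\<close> the claim is
      \<open>k * double_fact (k - 2) = double_fact k\<close>. At \<open>k = 1\<close> the
      subtraction truncates, and \<open>double_fact 0 = 1\<close> gives the right value.\<close>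
    proof (cases "card S")
      case 0 then show ?thesis using False less.prems by simp
    next
      case (Suc k) then show ?thesis by (cases k rule: double_fact.cases) auto
    qed
    finally show ?thesis .
  qed
qed

lemma p_eq_card: "p m = card (pair_partitions m)"
  by (simp add: p_def)

lemma card_matchings_eq_p: "finite S \<Longrightarrow> card (matchings S) = p (card S)"
  by (simp add: p_eq_card pair_partitions_eq_matchings card_matchings)

lemma p_eq: "p m = (if even m then double_fact (m - 1) else 0)"
  by (simp add: p_eq_card pair_partitions_eq_matchings card_matchings)

text \<open>A matching whose blocks never straddle the split is a matching of \<open>A\<close>
  together with an independent matching of \<open>B\<close>; union and restriction to
  \<open>Pow A\<close> and \<open>Pow B\<close> are inverse to each other.\<close>

lemma card_split_matchings:
  assumes "finite A" "finite B" "A \<inter> B = {}"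
  shows "card {W \<in> matchings (A \<union> B). \<forall>C\<in>W. C \<subseteq> A \<or> C \<subseteq> B} = p (card A) * p (card B)"
proof -
  let ?R = "{W \<in> matchings (A \<union> B). \<forall>C\<in>W. C \<subseteq> A \<or> C \<subseteq> B}"
  have "bij_betw (\<lambda>(V, W). V \<union> W) (matchings A \<times> matchings B) ?R"
  proof (rule bij_betw_byWitness[where f' = "\<lambda>W. (W \<inter> Pow A, W \<inter> Pow B)"])
    \<comment> \<open>\<open>Pow A\<close> and \<open>Pow B\<close> share the empty set, so
      recovering both components from their union relies on blocks being nonempty.\<close>
    have *: "V \<inter> Pow B' = {}" if "V \<in> matchings A'" "A' \<inter> B' = {}" for V and A' B' :: "'a set"
    proof -
      have "C = {}" if "C \<in> V" "C \<subseteq> B'" for C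
        using that \<open>V \<in> matchings A'\<close> \<open>A' \<inter> B' = {}\<close>
        by (auto simp: matchings_def partition_on_def)
      then show ?thesis using \<open>V \<in> matchings A'\<close> by (auto simp: matchings_def partition_on_def)
    qed
    have sub: "V \<subseteq> Pow A'" if "V \<in> matchings A'" for V and A' :: "'a set"
      using that by (auto simp: matchings_def partition_on_def)
    show "\<forall>a\<in>matchings A \<times> matchings B.
        ((case a of (V, W) \<Rightarrow> V \<union> W) \<inter> Pow A, (case a of (V, W) \<Rightarrow> V \<union> W) \<inter> Pow B) = a"
    proof
      fix a assume "a \<in> matchings A \<times> matchings B"
      then obtain V W where a: "a = (V, W)" and V: "V \<in> matchings A" and W: "W \<in> matchings B"
        by blast
      have "(V \<union> W) \<inter> Pow A = V" "(V \<union> W) \<inter> Pow B = W"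
        using sub[OF V] sub[OF W] *[OF V assms(3)] *[OF W, of A] assms(3) by blast+
      then show "((case a of (V, W) \<Rightarrow> V \<union> W) \<inter> Pow A, (case a of (V, W) \<Rightarrow> V \<union> W) \<inter> Pow B) = a"
        using a by simp
    qed
    show "\<forall>W\<in>?R. (case (W \<inter> Pow A, W \<inter> Pow B) of (V, W) \<Rightarrow> V \<union> W) = W" by auto
    show "(\<lambda>(V, W). V \<union> W) ` (matchings A \<times> matchings B) \<subseteq> ?R"
    proof (rule image_subsetI)
      fix a assume "a \<in> matchings A \<times> matchings B"
      then obtain V W where a: "a = (V, W)" and V: "V \<in> matchings A" and W: "W \<in> matchings B"
        by blast
      have "\<Union>V = A" "\<Union>W = B" using V W by (auto simp: matchings_def partition_on_def)
      then have "disjoint (V \<union> W)"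
        using V W assms(3) by (intro disjoint_union) (auto simp: matchings_def partition_on_def)
      then have "V \<union> W \<in> matchings (A \<union> B)"
        using V W by (auto simp: matchings_def partition_on_def)
      then show "(case a of (V, W) \<Rightarrow> V \<union> W) \<in> ?R"
        using a sub[OF V] sub[OF W] by auto
    qed
    show "(\<lambda>W. (W \<inter> Pow A, W \<inter> Pow B)) ` ?R \<subseteq> matchings A \<times> matchings B"
    proof (rule image_subsetI)
      fix W assume "W \<in> ?R"
      then have W: "W \<in> matchings (A \<union> B)" and s: "\<And>C. C \<in> W \<Longrightarrow> C \<subseteq> A \<or> C \<subseteq> B"
        by auto
      have U: "\<Union>W = A \<union> B" using W by (auto simp: matchings_def partition_on_def)
      have "x \<in> \<Union>(W \<inter> Pow A)" if "x \<in> A" for x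
      proof -
        obtain C where "C \<in> W" "x \<in> C" using \<open>x \<in> A\<close> U by blast
        moreover have "C \<subseteq> A" using s[OF \<open>C \<in> W\<close>] \<open>x \<in> C\<close> \<open>x \<in> A\<close> assms(3) by blast
        ultimately show ?thesis by blast
      qed
      then have "\<Union>(W \<inter> Pow A) = A" by blast
      moreover have "x \<in> \<Union>(W \<inter> Pow B)" if "x \<in> B" for x
      proof -
        obtain C where "C \<in> W" "x \<in> C" using \<open>x \<in> B\<close> U by blast
        moreover have "C \<subseteq> B" using s[OF \<open>C \<in> W\<close>] \<open>x \<in> C\<close> \<open>x \<in> B\<close> assms(3) by blast
        ultimately show ?thesis by blast
      qed
      then have "\<Union>(W \<inter> Pow B) = B" by blast
      moreover have "disjoint (W \<inter> X)" "{} \<notin> W" "\<forall>C\<in>W. card C = 2" for X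
        using W by (auto simp: matchings_def partition_on_def disjoint_def)
      ultimately show "(W \<inter> Pow A, W \<inter> Pow B) \<in> matchings A \<times> matchings B"
        unfolding matchings_def partition_on_def by blast
    qed
  qed
  then have "card ?R = card (matchings A \<times> matchings B)"
    by (rule bij_betw_same_card[symmetric])
  then show ?thesis using assms by (simp add: card_cartesian_product card_matchings_eq_p)
qed

section \<open>Uncrossed blocks\<close>

lemma card_2_obtain_less:
  fixes C :: "'a::linorder set"
  assumes "card C = 2"
  obtains a b where "C = {a, b}" "a < b"
proof -
  obtain a b where "C = {a, b}" "a \<noteq> b" using assms by (auto simp: card_2_iff)
  then show ?thesis
    using that[of a b] that[of b a] by (cases "a < b") (auto simp: insert_commute)
qed

text \<open>Crossing means that exactly one point of \<open>C\<close> lies strictly between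
  \<open>i\<close> and \<open>j\<close>. The outside counts as a single region: a block with one
  point left of \<open>i\<close> and the other right of \<open>j\<close> encloses
  \<open>{i, j}\<close> without crossing it.\<close>

lemma not_crosses_iff:
  assumes "i < j" "card C = 2" "C \<inter> {i, j} = {}"
  shows "\<not> crosses {i, j} C \<longleftrightarrow> C \<subseteq> {i<..<j} \<or> C \<subseteq> - {i..j}"
proof -
  obtain a b where C: "C = {a, b}" "a < b"
    using assms(2) by (rule card_2_obtain_less)
  have "crosses {i, j} C \<longleftrightarrow> i < a \<and> a < j \<and> j < b \<or> a < i \<and> i < b \<and> b < j"
    using assms(1) C by (auto simp: crosses_def doubleton_eq_iff)
  moreover have "a \<noteq> i" "a \<noteq> j" "b \<noteq> i" "b \<noteq> j" using assms(3) C(1) by auto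
  moreover have "C \<subseteq> {i<..<j} \<longleftrightarrow> i < a \<and> b < j"
    "C \<subseteq> - {i..j} \<longleftrightarrow> (a < i \<or> j < a) \<and> (b < i \<or> j < b)"
    using C by auto
  ultimately show ?thesis using assms(1) C(2) by linarith
qed

lemma card_noncrossing_block:
  assumes "i < j" "{i, j} \<subseteq> {1..m}"
  shows "card {V \<in> pair_partitions m. {i, j} \<in> singletons V} = p (j - i - 1) * p (m - (j - i + 1))"
proof -
  let ?A = "{i<..<j}" and ?B = "{1..m} - {i..j}"
  have S: "{1..m} - {i, j} = ?A \<union> ?B" using assms by auto
  have "{V \<in> pair_partitions m. {i, j} \<in> singletons V} =
    {V \<in> matchings {1..m}. {i, j} \<in> V \<and> (\<forall>C\<in>V - {{i, j}}. \<not> crosses {i, j} C)}"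
    by (auto simp: singletons_def pair_partitions_eq_matchings)
  also have "card \<dots> = card {W \<in> matchings (?A \<union> ?B). \<forall>C\<in>W. \<not> crosses {i, j} C}"
    using card_matchings_containing[OF assms(2), of "\<lambda>W. \<forall>C\<in>W. \<not> crosses {i, j} C"] assms(1) S
    by simp
  \<comment> \<open>The criterion \<open>not_crosses_iff\<close> uses the complement of
    \<open>{i..j}\<close> in all naturals; for blocks inside \<open>?A\<close> or \<open>?B\<close>
    or meeting both, this amounts to \<open>?B\<close>.\<close>
  also have "{W \<in> matchings (?A \<union> ?B). \<forall>C\<in>W. \<not> crosses {i, j} C} =
    {W \<in> matchings (?A \<union> ?B). \<forall>C\<in>W. C \<subseteq> ?A \<or> C \<subseteq> ?B}"
  proof (intro Collect_cong conj_cong ball_cong refl)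
    fix W C assume W: "W \<in> matchings (?A \<union> ?B)" "C \<in> W"
    then have "card C = 2" "C \<subseteq> ?A \<union> ?B"
      by (auto simp: matchings_def partition_on_def)
    moreover have "C \<inter> {i, j} = {}" using \<open>C \<subseteq> ?A \<union> ?B\<close> assms(1) by auto
    ultimately show "(\<not> crosses {i, j} C) = (C \<subseteq> ?A \<or> C \<subseteq> ?B)"
      using not_crosses_iff[OF assms(1)] by (auto; fastforce)
  qed
  also have "card \<dots> = p (card ?A) * p (card ?B)"
    by (rule card_split_matchings) auto
  also have "card ?B = m - (j - i + 1)"
    using assms by (subst card_Diff_subset) auto
  finally show ?thesis by simp
qed

section \<open>Summation over gaps\<close>

lemma T_eq_sum_gaps:
  "T (m + 2) = (\<Sum>d\<le>m. (m + 1 - d) * (p d * p (m - d)))"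
proof -
  let ?V = "pair_partitions (m + 2)"
  \<comment> \<open>A block is encoded by its gap \<open>d\<close> and left endpoint
    \<open>i\<close>. The right endpoint \<open>i + d + 1\<close> is at most \<open>m + 2\<close>
    exactly when \<open>i\<close> is at most \<open>m + 1 - d\<close>, which yields the weight in
    the sum.\<close>
  let ?D = "SIGMA d:{..m}. {1..m + 1 - d}"
  let ?b = "\<lambda>(d, i). {i, i + d + 1}"
  let ?E = "{B. B \<subseteq> {1..m + 2} \<and> card B = 2}"
  have fE: "finite ?E" by simp
  have "inj_on ?b ?D" by (auto simp: inj_on_def doubleton_eq_iff)
  moreover have "?b ` ?D = ?E"
  proof (intro equalityI subsetI)
    fix B assume "B \<in> ?E"
    then have "card B = 2" "B \<subseteq> {1..m + 2}" by auto
    then obtain i j where "B = {i, j}" "i < j" "{i, j} \<subseteq> {1..m + 2}"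
      using card_2_obtain_less[of B] by metis
    then show "B \<in> ?b ` ?D"
      by (intro image_eqI[of _ _ "(j - i - 1, i)"]) auto
  qed auto
  ultimately have bij: "bij_betw ?b ?D ?E" by (simp add: bij_betw_def)
  \<comment> \<open>The candidates \<open>?E\<close> do not depend on \<open>V\<close>, so the order
    of summation can be exchanged.\<close>
  have sing: "singletons V = {B \<in> ?E. B \<in> singletons V}" if "V \<in> ?V" for V
    using that by (auto simp: singletons_def pair_partitions_def partition_on_def)
  have "T (m + 2) = (\<Sum>V\<in>?V. card {B \<in> ?E. B \<in> singletons V})"
    unfolding T_def h_def using sing by (intro sum.cong refl arg_cong[of _ _ card]) auto
  also have "\<dots> = (\<Sum>B\<in>?E. card {V \<in> ?V. B \<in> singletons V})"
    using fE finite_pair_partitions by (intro sum_multicount_gen) auto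
  also have "\<dots> = (\<Sum>(d, i)\<in>?D. card {V \<in> ?V. {i, i + d + 1} \<in> singletons V})"
    using sum.reindex_bij_betw[OF bij, of "\<lambda>B. card {V \<in> ?V. B \<in> singletons V}"]
    by (simp add: case_prod_unfold)
  also have "\<dots> = (\<Sum>(d, i)\<in>?D. p d * p (m - d))"
  proof (intro sum.cong refl, clarify)
    fix d i assume "d \<le> m" "i \<in> {1..m + 1 - d}"
    then have "1 \<le> i" "i + d + 1 \<le> m + 2" by auto
    then show "card {V \<in> ?V. {i, i + d + 1} \<in> singletons V} = p d * p (m - d)"
      using card_noncrossing_block[of i "i + d + 1" "m + 2"] by auto
  qed
  also have "\<dots> = (\<Sum>d\<le>m. (m + 1 - d) * (p d * p (m - d)))"
    by (subst sum.Sigma[symmetric]) auto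
  finally show ?thesis .
qed

lemma T_eq_convolution:
  "T (2 * n + 2) = (n + 1) * (\<Sum>k=0..n. p (2 * k) * p (2 * n - 2 * k))"
proof -
  let ?f = "\<lambda>k. p (2 * k) * p (2 * n - 2 * k)"
  have "T (2 * n + 2) = (\<Sum>d\<in>(*) 2 ` {0..n}. (2 * n + 1 - d) * (p d * p (2 * n - d)))"
    unfolding T_eq_sum_gaps
  proof (rule sum.mono_neutral_right)
    \<comment> \<open>For an odd gap \<open>d\<close>, \<open>p d = 0\<close>.\<close>
    show "\<forall>d\<in>{..2 * n} - (*) 2 ` {0..n}. (2 * n + 1 - d) * (p d * p (2 * n - d)) = 0"
      by (auto simp: p_eq elim!: evenE)
  qed auto
  also have "\<dots> = (\<Sum>k=0..n. (2 * n + 1 - 2 * k) * ?f k)"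
    by (subst sum.reindex) (auto simp: inj_on_def)
  finally have T1: "T (2 * n + 2) = (\<Sum>k=0..n. (2 * n + 1 - 2 * k) * ?f k)" .
  \<comment> \<open>Reversing the sum fixes the product \<open>?f\<close>, which is symmetric under
    the reflection, and turns the weight into \<open>2 * k + 1\<close>.\<close>
  also have "\<dots> = (\<Sum>k=0..n. (2 * n + 1 - 2 * (n - k)) * ?f (n - k))"
    using sum.atLeastAtMost_rev[of "\<lambda>k. (2 * n + 1 - 2 * k) * ?f k" 0 n] by simp
  also have "\<dots> = (\<Sum>k=0..n. (2 * k + 1) * ?f k)"
  proof (intro sum.cong refl)
    fix k assume "k \<in> {0..n}"
    then have "2 * n + 1 - 2 * (n - k) = 2 * k + 1" "2 * (n - k) = 2 * n - 2 * k"
      "2 * n - (2 * n - 2 * k) = 2 * k" by auto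
    then show "(2 * n + 1 - 2 * (n - k)) * ?f (n - k) = (2 * k + 1) * ?f k"
      by (simp only: mult.commute)
  qed
  \<comment> \<open>Adding the two forms keeps the averaging within the naturals: the weights total
    \<open>2 * (n + 1)\<close>, where \<open>k\<close> being at most \<open>n\<close> rules out
    truncation, and the factor 2 cancels at the end.\<close>
  finally have "2 * T (2 * n + 2) =
    (\<Sum>k=0..n. (2 * n + 1 - 2 * k) * ?f k + (2 * k + 1) * ?f k)"
    using T1 by (simp add: sum.distrib)
  also have "\<dots> = (\<Sum>k=0..n. 2 * (n + 1) * ?f k)"
  proof (intro sum.cong refl)
    fix k assume "k \<in> {0..n}"
    then have "2 * n + 1 - 2 * k + (2 * k + 1) = 2 * (n + 1)" by auto
    then show "(2 * n + 1 - 2 * k) * ?f k + (2 * k + 1) * ?f k = 2 * (n + 1) * ?f k"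
      by (metis add_mult_distrib)
  qed
  also have "\<dots> = 2 * ((n + 1) * (\<Sum>k=0..n. ?f k))"
    by (simp add: sum_distrib_left mult.assoc)
  finally show ?thesis by simp
qed

theorem proposition1:
  shows "p 0 = 1 \<and>
    (\<forall>n::nat. n \<ge> 1 \<longrightarrow> p (2 * n) = double_fact (2 * n - 1)) \<and>
    (\<forall>n::nat. T (2 * n + 2) = (n + 1) * (\<Sum>k=0..n. p (2 * k) * p (2 * n - 2 * k)))"
  using T_eq_convolution by (simp add: p_eq)

end
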